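(* Let $\Gamma$ be a finitely generated group. (a) If $\Gamma$ is virtually $(\mathcal H,F)$-indicable, then any (not necessarily locally finite) Cayley graph $G$ of $\Gamma$ possesses a strong graph height function of the form $(h,\mathcal H)$. (b) If some Cayley graph $G$ of $\Gamma$ possesses a strong graph height function $(h,\mathcal H)$, then $\Gamma$ is virtually $\mathcal H$-indicable.
   Context: $\Gamma$ is virtually $(\mathcal H,F)$-indicable if $\mathcal H$ is a normal subgroup of $\Gamma$ of finite index and $F:\mathcal H\to\mathbb Z$ is a surjective homomorphism; virtually $\mathcal H$-indicable means this holds for some such $F$. A Cayley graph of $\Gamma$ with (possibly infinite) generator set $S$ has vertex set $\Gamma$ and edges $\langle g,gs\rangle$, $s\in S$. A strong graph height function on a Cayley graph $G$ of $\Gamma$ is a pair $(h,\mathcal H)$ where $\mathcal H$ is a normal subgroup of $\Gamma$ of finite index acting on $\Gamma$ by left multiplication, $h:\Gamma\to\mathbb Z$ satisfies $h(\mathrm{id})=0$, $h(\alpha v)-h(\alpha u)=h(v)-h(u)$ for all $\alpha\in\mathcal H$, $u,v\in\Gamma$, and every vertex $v$ has neighbours $u,w$ in $G$ with $h(u)<h(v)<h(w)$. *)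

theory Defs
  imports "HOL-Algebra.Generated_Groups" "HOL-Algebra.Elementary_Groups"
begin

definition generating_set :: "('a, 'b) monoid_scheme \<Rightarrow> 'a set \<Rightarrow> bool" where
  "generating_set \<Gamma> S \<longleftrightarrow> S \<subseteq> carrier \<Gamma> \<and> generate \<Gamma> S = carrier \<Gamma>"

definition finitely_generated :: "('a, 'b) monoid_scheme \<Rightarrow> bool" where
  "finitely_generated \<Gamma> \<longleftrightarrow> (\<exists>S. finite S \<and> generating_set \<Gamma> S)"

definition finite_index_normal :: "'a set \<Rightarrow> ('a, 'b) monoid_scheme \<Rightarrow> bool" where
  "finite_index_normal \<H> \<Gamma> \<longleftrightarrow> \<H> \<lhd> \<Gamma> \<and> finite (rcosets\<^bsub>\<Gamma>\<^esub> \<H>)"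

definition virtually_HF_indicable ::
    "('a, 'b) monoid_scheme \<Rightarrow> 'a set \<Rightarrow> ('a \<Rightarrow> int) \<Rightarrow> bool" where
  "virtually_HF_indicable \<Gamma> \<H> F \<longleftrightarrow>
     finite_index_normal \<H> \<Gamma> \<and> F \<in> epi (\<Gamma>\<lparr>carrier := \<H>\<rparr>) integer_group"

definition virtually_H_indicable :: "('a, 'b) monoid_scheme \<Rightarrow> 'a set \<Rightarrow> bool" where
  "virtually_H_indicable \<Gamma> \<H> \<longleftrightarrow> (\<exists>F. virtually_HF_indicable \<Gamma> \<H> F)"

text \<open>
  A graph is a set of vertices with a set of undirected edges; the edge joining \<open>u\<close> and \<open>v\<close> is
  the unordered pair \<open>{u, v}\<close>, and a loop at \<open>v\<close> is \<open>{v}\<close>.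
\<close>

type_synonym 'a graph = "'a set \<times> 'a set set"

definition neighbours :: "'a graph \<Rightarrow> 'a \<Rightarrow> 'a set" where
  "neighbours G v = {u \<in> fst G. {v, u} \<in> snd G}"

text \<open>
  The generating set may be infinite, need not be closed under inverses, and may contain the
  identity. Since edges are undirected, \<open>S\<close> and \<open>S \<union> S\<inverse>\<close> have the same Cayley graph.
\<close>

definition cayley_graph :: "('a, 'b) monoid_scheme \<Rightarrow> 'a set \<Rightarrow> 'a graph" where
  "cayley_graph \<Gamma> S = (carrier \<Gamma>, {{g, g \<otimes>\<^bsub>\<Gamma>\<^esub> s} | g s. g \<in> carrier \<Gamma> \<and> s \<in> S})"

definition is_cayley_graph_of :: "'a graph \<Rightarrow> ('a, 'b) monoid_scheme \<Rightarrow> bool" where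
  "is_cayley_graph_of G \<Gamma> \<longleftrightarrow> (\<exists>S. generating_set \<Gamma> S \<and> G = cayley_graph \<Gamma> S)"

definition strong_graph_height_function ::
    "('a, 'b) monoid_scheme \<Rightarrow> 'a graph \<Rightarrow> ('a \<Rightarrow> int) \<Rightarrow> 'a set \<Rightarrow> bool" where
  "strong_graph_height_function \<Gamma> G h \<H> \<longleftrightarrow>
     finite_index_normal \<H> \<Gamma> \<and>
     h \<one>\<^bsub>\<Gamma>\<^esub> = 0 \<and>
     (\<forall>\<alpha>\<in>\<H>. \<forall>u\<in>carrier \<Gamma>. \<forall>v\<in>carrier \<Gamma>.
        h (\<alpha> \<otimes>\<^bsub>\<Gamma>\<^esub> v) - h (\<alpha> \<otimes>\<^bsub>\<Gamma>\<^esub> u) = h v - h u) \<and>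
     (\<forall>v\<in>fst G. \<exists>u\<in>neighbours G v. \<exists>w\<in>neighbours G v. h u < h v \<and> h v < h w)"

end

theory Submission imports Complex_Main Defs begin

text \<open>
  For (a), pick a finite \<open>T \<subseteq> S\<close> generating an element on which \<open>F\<close> does not vanish. Minimising
  the Dirichlet energy along the edges of \<open>T\<close> over all \<open>f\<close> with \<open>f (\<alpha> v) = F \<alpha> + f v\<close> is a rational
  least-squares problem with one unknown per coset of \<open>\<H>\<close>; clearing denominators in a solution gives
  an integer-valued harmonic function that is not locally constant somewhere. At a vertex where it
  is not locally constant a harmonic function has both a higher and a lower neighbour. Left
  translates of harmonic functions are harmonic, and equivariance survives because \<open>\<H>\<close> is normal, so
  a generic integer combination of translates is locally constant at no vertex. The homomorphism
  induced by this combination on \<open>\<H>\<close> is in general not a multiple of \<open>F\<close>.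

  For (b), \<open>h\<close> restricts to a homomorphism on \<open>\<H>\<close>. If it vanished there, \<open>h\<close> would take finitely many
  values, so it would have a maximum, contradicting the existence of higher neighbours.
\<close>

section \<open>Least squares over an ordered field, and clearing denominators\<close>

text \<open>
  The proof eliminates one variable \<open>v\<close> by projecting all columns and \<open>c\<close> onto the orthogonal
  complement of the column of \<open>v\<close>.
\<close>

lemma normal_equations_solvable:
  fixes a :: "'i \<Rightarrow> 'v \<Rightarrow> 'k::linordered_field" and c :: "'i \<Rightarrow> 'k"
  assumes "finite V" and "finite I"
  shows "\<exists>x. \<forall>v\<in>V. (\<Sum>i\<in>I. a i v * (c i + (\<Sum>w\<in>V. a i w * x w))) = 0"
  using \<open>finite V\<close>
proof (induction V arbitrary: a c rule: finite_induct)
  case empty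
  show ?case by simp
next
  case (insert v V)
  define A where "A = (\<Sum>i\<in>I. a i v * a i v)"
  show ?case
  proof (cases "A = 0")
    case True
    \<comment> \<open>A sum of squares vanishes only termwise in an ordered field, so the column of
      \<open>v\<close> is zero: its equation is trivial and \<open>x v\<close> does not enter the
      others.\<close>
    then have av: "a i v = 0" if "i \<in> I" for i
      using that \<open>finite I\<close> unfolding A_def
      by (subst (asm) sum_nonneg_eq_0_iff) auto
    obtain x where "\<forall>u\<in>V. (\<Sum>i\<in>I. a i u * (c i + (\<Sum>w\<in>V. a i w * x w))) = 0"
      using insert.IH by blast
    with insert.hyps av show ?thesis
      by (intro exI[of _ x]) (auto intro!: sum.neutral)
  next
    case False
    \<comment> \<open>\<open>p l\<close> is the coefficient of the orthogonal projection of
      \<open>l\<close> onto the column of \<open>v\<close>; \<open>a'\<close> and \<open>c'\<close>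
      are what remains of the columns and of \<open>c\<close>.\<close>
    define p where "p l = (\<Sum>j\<in>I. a j v * l j) / A" for l :: "'i \<Rightarrow> 'k"
    define a' where "a' i w = a i w - a i v * p (\<lambda>j. a j w)" for i w
    define c' where "c' i = c i - a i v * p c" for i
    obtain x where x: "\<forall>u\<in>V. (\<Sum>i\<in>I. a' i u * (c' i + (\<Sum>w\<in>V. a' i w * x w))) = 0"
      using insert.IH by blast
    define l where "l i = c i + (\<Sum>w\<in>V. a i w * x w)" for i
    \<comment> \<open>The coefficient \<open>- p l\<close> makes the residual \<open>r\<close>
      orthogonal to the column of \<open>v\<close>.\<close>
    define y where "y = x(v := - p l)"
    define r where "r i = l i - a i v * p l" for i
    \<comment> \<open>Linearity of \<open>p\<close>: it gives the reduced system at \<open>x\<close>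
      and the full system at \<open>y\<close> the same residual \<open>r\<close>.\<close>
    have pl: "p l = p c + (\<Sum>w\<in>V. p (\<lambda>j. a j w) * x w)"
    proof -
      have "(\<Sum>j\<in>I. a j v * (\<Sum>w\<in>V. a j w * x w)) = (\<Sum>w\<in>V. (\<Sum>j\<in>I. a j v * a j w) * x w)"
        unfolding sum_distrib_left sum_distrib_right by (subst sum.swap) (simp add: mult.assoc)
      then show ?thesis
        unfolding p_def l_def
        by (simp add: distrib_left sum.distrib add_divide_distrib sum_divide_distrib[symmetric])
    qed
    have r: "c' i + (\<Sum>w\<in>V. a' i w * x w) = r i" for i
      unfolding r_def pl l_def a'_def c'_def
      by (simp add: algebra_simps sum_subtractf sum_distrib_left)
    have y: "c i + (\<Sum>w\<in>insert v V. a i w * y w) = r i" for i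
    proof -
      have "(\<Sum>w\<in>V. a i w * y w) = (\<Sum>w\<in>V. a i w * x w)"
        using insert.hyps by (intro sum.cong) (auto simp: y_def)
      then show ?thesis
        using insert.hyps by (simp add: y_def r_def l_def)
    qed
    have rv: "(\<Sum>i\<in>I. a i v * r i) = 0"
    proof -
      have "(\<Sum>i\<in>I. a i v * r i) = (\<Sum>i\<in>I. a i v * l i) - A * p l"
        by (simp add: r_def A_def algebra_simps sum_subtractf sum_distrib_left)
      then show ?thesis using False by (simp add: p_def)
    qed
    have "(\<Sum>i\<in>I. a i u * r i) = 0" if "u \<in> V" for u
    proof -
      have "(\<Sum>i\<in>I. a i u * r i) =
          (\<Sum>i\<in>I. a' i u * r i) + p (\<lambda>j. a j u) * (\<Sum>i\<in>I. a i v * r i)"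
        by (simp add: a'_def algebra_simps sum_subtractf sum_distrib_left)
      then show ?thesis using x that rv r by simp
    qed
    with rv show ?thesis
      unfolding y[symmetric] by (intro exI[of _ y]) auto
  qed
qed

lemma common_denominator:
  fixes X :: "rat set"
  assumes "finite X"
  shows "\<exists>D::int. D > 0 \<and> (\<forall>x\<in>X. of_int D * x \<in> \<int>)"
  using assms
proof (induction X rule: finite_induct)
  case empty
  show ?case by (auto intro: exI[of _ 1])
next
  case (insert x X)
  then obtain D :: int where D: "D > 0" "\<forall>x\<in>X. of_int D * x \<in> \<int>" by blast
  obtain p q :: int where pq: "q > 0" "x = of_int p / of_int q"
    by (metis quotient_of_div quotient_of_denom_pos surj_pair)
  have "of_int (D * q) * x = of_int (D * p)" using pq by simp
  moreover have "of_int (D * q) * y \<in> \<int>" if "y \<in> X" for y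
  proof -
    have "of_int (D * q) * y = of_int q * (of_int D * y)" by simp
    then show ?thesis using D that by (metis Ints_mult Ints_of_int)
  qed
  ultimately show ?case
    using D pq by (intro exI[of _ "D * q"]) auto
qed

section \<open>Words in the generators\<close>

text \<open>A word has finitely many letters. This lets harmonicity be a finite sum even when the
  Cayley graph has infinitely many generators.\<close>

lemma (in group) generate_finite_subset:
  assumes "x \<in> generate G S"
  shows "\<exists>T. finite T \<and> T \<subseteq> S \<and> x \<in> generate G T"
  using assms
proof induction
  case one
  show ?case using generate.one by blast
next
  case (incl h)
  then show ?case by (intro exI[of _ "{h}"]) (auto intro: generate.incl)
next
  case (inv h)
  then show ?case by (intro exI[of _ "{h}"]) (auto intro: generate.inv)
next
  case (eng h1 h2)
  then obtain T1 T2 where "finite T1" "T1 \<subseteq> S" "h1 \<in> generate G T1"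
    "finite T2" "T2 \<subseteq> S" "h2 \<in> generate G T2" by blast
  then show ?case
    using mono_generate[of T1 "T1 \<union> T2"] mono_generate[of T2 "T1 \<union> T2"]
    by (intro exI[of _ "T1 \<union> T2"]) (auto intro!: generate.eng)
qed

text \<open>Used contrapositively: a function with different values at \<open>v\<close> and
  \<open>v \<otimes> x\<close> changes along some edge labelled by \<open>S\<close>.\<close>

lemma (in group) constant_on_generate:
  assumes "S \<subseteq> carrier G" and "x \<in> generate G S" and "v \<in> carrier G"
    and const: "\<And>v s. v \<in> carrier G \<Longrightarrow> s \<in> S \<Longrightarrow> f (v \<otimes> s) = f v"
  shows "f (v \<otimes> x) = f v"
  using assms(2,3)
proof (induction arbitrary: v)
  case one
  then show ?case by simp
next
  case (incl h)
  then show ?case using const by blast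
next
  case (inv h)
  then have "h \<in> carrier G" using assms(1) by blast
  with inv const[of "v \<otimes> inv h" h] show ?case by (simp add: m_assoc)
next
  case (eng h1 h2)
  have "h1 \<in> carrier G" "h2 \<in> carrier G"
    using eng generate_in_carrier[OF assms(1)] by blast+
  with eng show ?case by (simp add: m_assoc[symmetric])
qed

section \<open>Extending a homomorphism on \<open>H\<close> to an equivariant harmonic
  function\<close>

lemma (in normal) rcos_mult_left:
  assumes "\<alpha> \<in> H" and "v \<in> carrier G"
  shows "H #> (\<alpha> \<otimes> v) = H #> v"
  using coset_mult_assoc[OF subset mem_carrier assms(2), of \<alpha>] assms
    coset_join2[OF mem_carrier is_subgroup, of \<alpha>] by simp

lemma (in normal) coset_representatives:
  obtains \<rho> where "\<And>v. v \<in> carrier G \<Longrightarrow> \<rho> (H #> v) \<in> carrier G"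
    and "\<And>v. v \<in> carrier G \<Longrightarrow> \<exists>\<beta>\<in>H. v = \<beta> \<otimes> \<rho> (H #> v)"
proof
  define rep where "rep C = (SOME v. v \<in> carrier G \<and> C = H #> v)" for C
  have rep: "rep (H #> v) \<in> carrier G \<and> H #> v = H #> rep (H #> v)" if "v \<in> carrier G" for v
    unfolding rep_def by (rule someI_ex) (use that in blast)
  fix v assume v: "v \<in> carrier G"
  show "rep (H #> v) \<in> carrier G" using rep[OF v] by blast
  have "v \<in> H #> rep (H #> v)"
    using rep[OF v] rcos_self[OF v is_subgroup] by simp
  then show "\<exists>\<beta>\<in>H. v = \<beta> \<otimes> rep (H #> v)"
    unfolding r_coset_def by blast
qed

text \<open>\<open>f v\<close> is \<open>F\<close> of the \<open>H\<close>-component of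
  \<open>v\<close> relative to its coset representative; left multiplication by
  \<open>\<alpha>\<close> keeps the representative and multiplies that component by
  \<open>\<alpha>\<close>.\<close>

lemma (in normal) equivariant_extension:
  fixes F :: "'a \<Rightarrow> int"
  assumes F: "F \<in> hom (G\<lparr>carrier := H\<rparr>) integer_group"
  shows "\<exists>f. \<forall>\<alpha>\<in>H. \<forall>v\<in>carrier G. f (\<alpha> \<otimes> v) = F \<alpha> + f v"
proof -
  obtain rep where rep: "\<And>v. v \<in> carrier G \<Longrightarrow> rep (H #> v) \<in> carrier G"
      "\<And>v. v \<in> carrier G \<Longrightarrow> \<exists>\<beta>\<in>H. v = \<beta> \<otimes> rep (H #> v)"
    using coset_representatives by blast
  have inH: "v \<otimes> inv rep (H #> v) \<in> H" if v: "v \<in> carrier G" for v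
  proof -
    obtain \<beta> where \<beta>: "\<beta> \<in> H" "v = \<beta> \<otimes> rep (H #> v)" using rep(2)[OF v] by blast
    then have "v \<otimes> inv rep (H #> v) = \<beta>"
      using rep(1)[OF v] mem_carrier v inv_solve_right' by metis
    with \<beta> show ?thesis by simp
  qed
  define f where "f v = F (v \<otimes> inv rep (H #> v))" for v
  have "f (\<alpha> \<otimes> v) = F \<alpha> + f v" if "\<alpha> \<in> H" "v \<in> carrier G" for \<alpha> v
    using F inH[OF that(2)] rep(1)[OF that(2)] that
    by (simp add: f_def rcos_mult_left m_assoc hom_def integer_group_def)
  then show ?thesis by blast
qed

text \<open>Vanishing of the graph Laplacian, written without division as a balance of outgoing and
  incoming increments. It is meant for finite \<open>S\<close>, since a sum over an infinite set is
  0.\<close>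

definition (in group) harmonic :: "'a set \<Rightarrow> ('a \<Rightarrow> 'k::comm_ring) \<Rightarrow> bool" where
  "harmonic S f \<longleftrightarrow>
     (\<forall>v\<in>carrier G. (\<Sum>s\<in>S. f (v \<otimes> s) - f v) = (\<Sum>s\<in>S. f v - f (v \<otimes> inv s)))"

text \<open>A correction depending only on the coset keeps \<open>f0\<close> equivariant, and edge
  increments depend only on coset and label. The energy is thus a finite sum of squares, and its
  normal equations express harmonicity.\<close>

lemma (in normal) harmonic_extension_rat:
  fixes f0 :: "'a \<Rightarrow> int" and F :: "'a \<Rightarrow> int"
  assumes f0: "\<And>\<alpha> v. \<alpha> \<in> H \<Longrightarrow> v \<in> carrier G \<Longrightarrow> f0 (\<alpha> \<otimes> v) = F \<alpha> + f0 v"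
    and fin: "finite (rcosets H)" and S: "finite S" "S \<subseteq> carrier G"
  shows "\<exists>x. harmonic S (\<lambda>v. of_int (f0 v) + x (H #> v) :: rat)"
proof -
  let ?Q = "rcosets H"
  obtain rep where rep: "\<And>v. v \<in> carrier G \<Longrightarrow> rep (H #> v) \<in> carrier G"
      "\<And>v. v \<in> carrier G \<Longrightarrow> \<exists>\<beta>\<in>H. v = \<beta> \<otimes> rep (H #> v)"
    using coset_representatives by blast
  \<comment> \<open>\<open>c\<close> holds the increments of \<open>f0\<close>, read off at
    representatives; \<open>a\<close> is the incidence matrix of the graph on cosets, so it turns
    \<open>x\<close> into its increments.\<close>
  define c :: "'a set \<times> 'a \<Rightarrow> rat" where
    "c = (\<lambda>(C, s). of_int (f0 (rep C \<otimes> s) - f0 (rep C)))"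
  define a :: "'a set \<times> 'a \<Rightarrow> 'a set \<Rightarrow> rat" where
    "a = (\<lambda>(C, s) w. of_bool (C #> s = w) - of_bool (C = w))"
  have Q: "H #> v \<in> ?Q" if "v \<in> carrier G" for v
    using that by (auto simp: RCOSETS_def)
  have QE: "\<exists>v\<in>carrier G. C = H #> v" if "C \<in> ?Q" for C
    using that by (auto simp: RCOSETS_def)
  have assoc: "(H #> v) #> s = H #> (v \<otimes> s)" if "v \<in> carrier G" "s \<in> carrier G" for v s
    using that by (simp add: coset_mult_assoc subset)
  \<comment> \<open>\<open>F \<alpha>\<close> cancels in the difference, so the increment may be
    taken at any vertex of the coset.\<close>
  have c: "c (H #> v, s) = of_int (f0 (v \<otimes> s) - f0 v)" if v: "v \<in> carrier G" and s: "s \<in> S" for v s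
  proof -
    let ?r = "rep (H #> v)"
    have r: "?r \<in> carrier G" using rep(1)[OF v] .
    obtain \<alpha> where \<alpha>: "\<alpha> \<in> H" "v = \<alpha> \<otimes> ?r" using rep(2)[OF v] by blast
    have sc: "s \<in> carrier G" using s S by blast
    have "v \<otimes> s = \<alpha> \<otimes> (?r \<otimes> s)"
      using \<alpha> r sc by (metis m_assoc mem_carrier)
    then have "f0 (v \<otimes> s) = F \<alpha> + f0 (?r \<otimes> s)"
      using f0[of \<alpha> "?r \<otimes> s"] \<alpha>(1) r sc by simp
    moreover have "f0 v = F \<alpha> + f0 ?r"
      using f0[of \<alpha> ?r] \<alpha> r by metis
    ultimately show ?thesis by (simp add: c_def)
  qed
  obtain x where x: "\<forall>w\<in>?Q. (\<Sum>i\<in>?Q \<times> S. a i w * (c i + (\<Sum>w\<in>?Q. a i w * x w))) = 0"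
    using normal_equations_solvable[of ?Q "?Q \<times> S" a c] fin S by blast
  \<comment> \<open>\<open>d C s\<close> is the increment of \<open>f\<close> along the edges labelled \<open>s\<close> that leave \<open>C\<close>.\<close>
  define d where "d C s = c (C, s) + (x (C #> s) - x C)" for C s
  define f where "f v = of_int (f0 v) + x (H #> v)" for v
  have shift: "C #> s \<in> ?Q" if "C \<in> ?Q" "s \<in> carrier G" for C s
    using QE[OF that(1)] that(2) assoc Q by auto
  have d: "d (H #> v) s = f (v \<otimes> s) - f v" if "v \<in> carrier G" "s \<in> S" for v s
    using that c[OF that] S assoc[of v s] by (auto simp: d_def f_def)
  have inner: "c (C, s) + (\<Sum>w\<in>?Q. a (C, s) w * x w) = d C s" if "C \<in> ?Q" "s \<in> S" for C s
    using that fin shift[of C s] S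
    by (auto simp: d_def a_def left_diff_distrib sum_subtractf of_bool_def if_distrib[of "\<lambda>z. z * _"]
        cong: if_cong)
  have "(\<Sum>s\<in>S. f (v \<otimes> s) - f v) = (\<Sum>s\<in>S. f v - f (v \<otimes> inv s))" if v: "v \<in> carrier G" for v
  proof -
    let ?w = "H #> v"
    \<comment> \<open>Right multiplication by \<open>s\<close> permutes the cosets, so the column of
      \<open>a\<close> at \<open>?w\<close> meets one incoming edge labelled \<open>s\<close>, with
      sign plus, and one outgoing edge, with sign minus.\<close>
    have row: "(\<Sum>C\<in>?Q. a (C, s) ?w * d C s) = (f v - f (v \<otimes> inv s)) - (f (v \<otimes> s) - f v)"
      if s: "s \<in> S" for s
    proof -
      have sc: "s \<in> carrier G" using s S by blast
      have eq: "C #> s = ?w \<longleftrightarrow> C = H #> (v \<otimes> inv s)" if C: "C \<in> ?Q" for C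
      proof -
        obtain u where u: "u \<in> carrier G" "C = H #> u" using QE[OF C] by blast
        show ?thesis
          using u sc v assoc[of u s] assoc[of "u \<otimes> s" "inv s"] assoc[of v "inv s"] assoc[of "v \<otimes> inv s" s]
          by (auto simp: m_assoc)
      qed
      have "(\<Sum>C\<in>?Q. a (C, s) ?w * d C s) =
          (\<Sum>C\<in>?Q. of_bool (C = H #> (v \<otimes> inv s)) * d C s) - (\<Sum>C\<in>?Q. of_bool (C = ?w) * d C s)"
        by (simp add: a_def left_diff_distrib sum_subtractf eq)
      also have "\<dots> = d (H #> (v \<otimes> inv s)) s - d ?w s"
        using fin Q[of v] Q[of "v \<otimes> inv s"] v sc
        by (auto simp: of_bool_def if_distrib[of "\<lambda>z. z * _"] cong: if_cong)
      finally show ?thesis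
        using d[of v s] d[of "v \<otimes> inv s" s] v s sc by (simp add: m_assoc)
    qed
    have "0 = (\<Sum>C\<in>?Q. \<Sum>s\<in>S. a (C, s) ?w * (c (C, s) + (\<Sum>w\<in>?Q. a (C, s) w * x w)))"
      using x Q[OF v] by (simp add: sum.cartesian_product')
    also have "\<dots> = (\<Sum>C\<in>?Q. \<Sum>s\<in>S. a (C, s) ?w * d C s)"
      by (intro sum.cong refl) (simp add: inner)
    also have "\<dots> = (\<Sum>s\<in>S. \<Sum>C\<in>?Q. a (C, s) ?w * d C s)"
      by (rule sum.swap)
    also have "\<dots> = (\<Sum>s\<in>S. (f v - f (v \<otimes> inv s)) - (f (v \<otimes> s) - f v))"
      by (intro sum.cong refl row)
    also have "\<dots> = (\<Sum>s\<in>S. f v - f (v \<otimes> inv s)) - (\<Sum>s\<in>S. f (v \<otimes> s) - f v)"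
      by (rule sum_subtractf)
    finally show ?thesis by simp
  qed
  then show ?thesis
    unfolding harmonic_def f_def by blast
qed

text \<open>Equivalently, \<open>f (\<alpha> \<otimes> v) - f v\<close> is independent of
  \<open>v\<close>. The induced homomorphism is left unnamed, as translates and combinations can
  change it.\<close>

definition (in group) equivariant :: "'a set \<Rightarrow> ('a \<Rightarrow> 'k::ab_group_add) \<Rightarrow> bool" where
  "equivariant H f \<longleftrightarrow>
     (\<forall>\<alpha>\<in>H. \<forall>u\<in>carrier G. \<forall>v\<in>carrier G. f (\<alpha> \<otimes> v) - f (\<alpha> \<otimes> u) = f v - f u)"

text \<open>\<open>D\<close> is a common denominator of the finitely many corrections in the
  rational solution; \<open>D > 0\<close> keeps the shift nonzero wherever \<open>F\<close>
  is.\<close>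

lemma (in normal) harmonic_extension:
  fixes F :: "'a \<Rightarrow> int"
  assumes F: "F \<in> hom (G\<lparr>carrier := H\<rparr>) integer_group"
    and fin: "finite (rcosets H)" and S: "finite S" "S \<subseteq> carrier G"
  shows "\<exists>D h. D > 0 \<and> harmonic S h \<and> (\<forall>\<alpha>\<in>H. \<forall>v\<in>carrier G. h (\<alpha> \<otimes> v) = D * F \<alpha> + h v)"
proof -
  obtain f0 where f0: "\<forall>\<alpha>\<in>H. \<forall>v\<in>carrier G. f0 (\<alpha> \<otimes> v) = F \<alpha> + f0 v"
    using equivariant_extension[OF F] by blast
  obtain x :: "'a set \<Rightarrow> rat" where x: "harmonic S (\<lambda>v. of_int (f0 v) + x (H #> v))"
    using harmonic_extension_rat[of f0 F S] f0 fin S by blast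
  obtain D :: int where D: "D > 0" "\<forall>C\<in>rcosets H. of_int D * x C \<in> \<int>"
    using common_denominator[of "x ` (rcosets H)"] fin by auto
  \<comment> \<open>The floor is exact on cosets, as \<open>D\<close> clears the denominators; it
    only turns a rational into an \<open>int\<close>.\<close>
  define h where "h v = D * f0 v + \<lfloor>of_int D * x (H #> v)\<rfloor>" for v
  have h: "of_int (h v) = of_int D * (of_int (f0 v) + x (H #> v))" if "v \<in> carrier G" for v
  proof -
    have "H #> v \<in> rcosets H" using that by (auto simp: RCOSETS_def)
    then have "of_int \<lfloor>of_int D * x (H #> v)\<rfloor> = of_int D * x (H #> v)"
      using D by (simp add: of_int_floor)
    then show ?thesis by (simp add: h_def distrib_left)
  qed
  have "harmonic S h"
    unfolding harmonic_def
  proof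
    fix v assume v: "v \<in> carrier G"
    let ?f = "\<lambda>v. of_int (f0 v) + x (H #> v)"
    have "of_int (\<Sum>s\<in>S. h (v \<otimes> s) - h v) = of_int D * (\<Sum>s\<in>S. ?f (v \<otimes> s) - ?f v)"
      unfolding of_int_sum sum_distrib_left using v S
      by (intro sum.cong) (auto simp: h right_diff_distrib)
    also have "\<dots> = of_int D * (\<Sum>s\<in>S. ?f v - ?f (v \<otimes> inv s))"
      using x v unfolding harmonic_def by simp
    also have "\<dots> = of_int (\<Sum>s\<in>S. h v - h (v \<otimes> inv s))"
      unfolding of_int_sum sum_distrib_left using v S
      by (intro sum.cong) (auto simp: h right_diff_distrib subset_iff)
    finally show "(\<Sum>s\<in>S. h (v \<otimes> s) - h v) = (\<Sum>s\<in>S. h v - h (v \<otimes> inv s))"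
      using of_int_eq_iff by blast
  qed
  moreover have "\<forall>\<alpha>\<in>H. \<forall>v\<in>carrier G. h (\<alpha> \<otimes> v) = D * F \<alpha> + h v"
    using f0 by (simp add: h_def rcos_mult_left distrib_left)
  ultimately show ?thesis using D by blast
qed

section \<open>Combinations and left translates of harmonic functions\<close>

lemma (in group) harmonic_add_scaled:
  "harmonic S f \<Longrightarrow> harmonic S g \<Longrightarrow> harmonic S (\<lambda>v. f v + c * g v)"
  unfolding harmonic_def
proof
  fix v
  assume f: "\<forall>v\<in>carrier G. (\<Sum>s\<in>S. f (v \<otimes> s) - f v) = (\<Sum>s\<in>S. f v - f (v \<otimes> inv s))"
    and g: "\<forall>v\<in>carrier G. (\<Sum>s\<in>S. g (v \<otimes> s) - g v) = (\<Sum>s\<in>S. g v - g (v \<otimes> inv s))"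
    and v: "v \<in> carrier G"
  have "(\<Sum>s\<in>S. f (v \<otimes> s) + c * g (v \<otimes> s) - (f v + c * g v)) =
      (\<Sum>s\<in>S. f (v \<otimes> s) - f v) + c * (\<Sum>s\<in>S. g (v \<otimes> s) - g v)"
    by (simp add: sum_distrib_left sum.distrib[symmetric] algebra_simps)
  also have "\<dots> = (\<Sum>s\<in>S. f v - f (v \<otimes> inv s)) + c * (\<Sum>s\<in>S. g v - g (v \<otimes> inv s))"
    using f g v by simp
  also have "\<dots> = (\<Sum>s\<in>S. f v + c * g v - (f (v \<otimes> inv s) + c * g (v \<otimes> inv s)))"
    by (simp add: sum_distrib_left sum.distrib[symmetric] algebra_simps)
  finally show "(\<Sum>s\<in>S. f (v \<otimes> s) + c * g (v \<otimes> s) - (f v + c * g v)) =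
      (\<Sum>s\<in>S. f v + c * g v - (f (v \<otimes> inv s) + c * g (v \<otimes> inv s)))" .
qed

lemma (in group) equivariant_add_scaled:
  fixes f g :: "'a \<Rightarrow> 'k::comm_ring"
  assumes f: "equivariant H f" and g: "equivariant H g"
  shows "equivariant H (\<lambda>v. f v + c * g v)"
  unfolding equivariant_def
proof (intro ballI)
  fix \<alpha> u v assume *: "\<alpha> \<in> H" "u \<in> carrier G" "v \<in> carrier G"
  have "f (\<alpha> \<otimes> v) + c * g (\<alpha> \<otimes> v) - (f (\<alpha> \<otimes> u) + c * g (\<alpha> \<otimes> u)) =
      (f (\<alpha> \<otimes> v) - f (\<alpha> \<otimes> u)) + c * (g (\<alpha> \<otimes> v) - g (\<alpha> \<otimes> u))"
    by (simp add: algebra_simps)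
  also have "\<dots> = (f v - f u) + c * (g v - g u)"
    using f g * unfolding equivariant_def by simp
  finally show "f (\<alpha> \<otimes> v) + c * g (\<alpha> \<otimes> v) - (f (\<alpha> \<otimes> u) + c * g (\<alpha> \<otimes> u)) =
      f v + c * g v - (f u + c * g u)"
    by (simp add: algebra_simps)
qed

lemma (in group) harmonic_translate:
  assumes "harmonic S f" and "g \<in> carrier G" and "S \<subseteq> carrier G"
  shows "harmonic S (\<lambda>v. f (g \<otimes> v))"
  unfolding harmonic_def
proof
  fix v assume v: "v \<in> carrier G"
  have "(\<Sum>s\<in>S. f (g \<otimes> (v \<otimes> s)) - f (g \<otimes> v)) = (\<Sum>s\<in>S. f ((g \<otimes> v) \<otimes> s) - f (g \<otimes> v))"
    using v assms by (intro sum.cong refl) (simp add: m_assoc subset_iff)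
  also have "\<dots> = (\<Sum>s\<in>S. f (g \<otimes> v) - f ((g \<otimes> v) \<otimes> inv s))"
    using v assms unfolding harmonic_def by simp
  also have "\<dots> = (\<Sum>s\<in>S. f (g \<otimes> v) - f (g \<otimes> (v \<otimes> inv s)))"
    using v assms by (intro sum.cong refl) (simp add: m_assoc subset_iff)
  finally show "(\<Sum>s\<in>S. f (g \<otimes> (v \<otimes> s)) - f (g \<otimes> v)) =
      (\<Sum>s\<in>S. f (g \<otimes> v) - f (g \<otimes> (v \<otimes> inv s)))" .
qed

text \<open>By normality \<open>g \<otimes> \<alpha>\<close> is a conjugate of
  \<open>\<alpha>\<close>, again in \<open>H\<close>, times \<open>g\<close>.\<close>

lemma (in normal) equivariant_translate:
  assumes "equivariant H f" and "g \<in> carrier G"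
  shows "equivariant H (\<lambda>v. f (g \<otimes> v))"
  unfolding equivariant_def
proof (intro ballI)
  fix \<alpha> u v assume *: "\<alpha> \<in> H" "u \<in> carrier G" "v \<in> carrier G"
  have \<beta>: "g \<otimes> \<alpha> \<otimes> inv g \<in> H" using assms * inv_op_closed2 by blast
  have eq: "g \<otimes> (\<alpha> \<otimes> w) = (g \<otimes> \<alpha> \<otimes> inv g) \<otimes> (g \<otimes> w)" if "w \<in> carrier G" for w
    using that assms * mem_carrier by (simp add: m_assoc inv_solve_left)
  show "f (g \<otimes> (\<alpha> \<otimes> v)) - f (g \<otimes> (\<alpha> \<otimes> u)) = f (g \<otimes> v) - f (g \<otimes> u)"
    using assms * \<beta> unfolding equivariant_def by (simp add: eq)
qed

text \<open>Vertices are added to \<open>A\<close> one at a time, each time adding a multiple of a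
  translate of \<open>f\<close> that changes at the new vertex. Each vertex rules out at most one
  multiplier.\<close>

lemma (in normal) harmonic_nowhere_locally_constant:
  fixes f :: "'a \<Rightarrow> int"
  assumes f: "harmonic S f" "equivariant H f" and S: "S \<subseteq> carrier G"
    and v0: "v0 \<in> carrier G" "s0 \<in> S" "f (v0 \<otimes> s0) \<noteq> f v0"
    and A: "finite A" "A \<subseteq> carrier G"
  shows "\<exists>h :: 'a \<Rightarrow> int. harmonic S h \<and> equivariant H h \<and> (\<forall>v\<in>A. \<exists>s\<in>S. h (v \<otimes> s) \<noteq> h v)"
  using A
proof (induction A rule: finite_induct)
  case empty
  then show ?case using f by blast
next
  case (insert v A)
  then obtain h :: "'a \<Rightarrow> int" where h: "harmonic S h" "equivariant H h"
      "\<forall>a\<in>A. \<exists>s\<in>S. h (a \<otimes> s) \<noteq> h a"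
    by auto
  have v: "v \<in> carrier G" using insert by simp
  \<comment> \<open>Left multiplication by \<open>g\<close> carries \<open>v\<close> to
    \<open>v0\<close>, and the edge labelled \<open>s0\<close> along with it.\<close>
  define g where "g = v0 \<otimes> inv v"
  have g: "g \<in> carrier G" using v v0 by (simp add: g_def)
  define k where "k w = f (g \<otimes> w)" for w
  have k: "harmonic S k" "equivariant H k"
    unfolding k_def using harmonic_translate equivariant_translate f g S by auto
  have kv: "k (v \<otimes> s0) \<noteq> k v"
  proof -
    have "s0 \<in> carrier G" using v0 S by blast
    then have "g \<otimes> v = v0" "g \<otimes> (v \<otimes> s0) = v0 \<otimes> s0"
      using v v0 by (simp_all add: g_def m_assoc flip: m_assoc[of "inv v" v s0])
    then show ?thesis using v0 by (simp add: k_def)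
  qed
  have "\<exists>s. s \<in> S \<and> (h (a \<otimes> s) \<noteq> h a \<or> k (a \<otimes> s) \<noteq> k a)" if "a \<in> insert v A" for a
    using that h(3) kv v0 by blast
  then obtain \<sigma> where \<sigma>: "\<And>a. a \<in> insert v A \<Longrightarrow> \<sigma> a \<in> S"
      "\<And>a. a \<in> insert v A \<Longrightarrow> h (a \<otimes> \<sigma> a) \<noteq> h a \<or> k (a \<otimes> \<sigma> a) \<noteq> k a"
    by metis
  \<comment> \<open>The multipliers \<open>n\<close> for which \<open>h + n * k\<close> does not
    change along the chosen edge at \<open>a\<close>: roots of a linear equation whose coefficients
    are not both 0.\<close>
  define bad where "bad a = {n::int. (h (a \<otimes> \<sigma> a) - h a) + n * (k (a \<otimes> \<sigma> a) - k a) = 0}" for a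
  have "finite (bad a)" if "a \<in> insert v A" for a
  proof (cases "k (a \<otimes> \<sigma> a) = k a")
    case True
    then have "bad a = {}" using \<sigma>(2)[OF that] by (auto simp: bad_def)
    then show ?thesis by simp
  next
    case False
    have "m = n" if "m \<in> bad a" "n \<in> bad a" for m n
    proof -
      have "(m - n) * (k (a \<otimes> \<sigma> a) - k a) = 0"
        using that by (simp add: bad_def algebra_simps)
      then show ?thesis using False by simp
    qed
    then show ?thesis
      by (metis finite.simps subsetI subset_singletonD singleton_iff finite_subset ex_in_conv)
  qed
  then have "finite (\<Union>a\<in>insert v A. bad a)" using insert.hyps by blast
  then obtain n where n: "n \<notin> (\<Union>a\<in>insert v A. bad a)"
    using ex_new_if_finite infinite_UNIV_int by blast
  have "(h (a \<otimes> \<sigma> a) + n * k (a \<otimes> \<sigma> a)) \<noteq> h a + n * k a" if "a \<in> insert v A" for a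
    using n that by (auto simp: bad_def algebra_simps)
  then show ?case
    using \<sigma>(1) h k harmonic_add_scaled[OF h(1) k(1), of n] equivariant_add_scaled[OF h(2) k(2), of n]
    by (intro exI[of _ "\<lambda>w. h w + n * k w"]) blast
qed

section \<open>Height functions from indicability\<close>

text \<open>Minimum principle: without a lower neighbour the outgoing increments would sum to a
  positive number and the incoming ones to at most 0, against the balance.\<close>

lemma (in group) harmonic_has_lower:
  fixes h :: "'a \<Rightarrow> 'k::linordered_idom"
  assumes h: "harmonic S h" and S: "finite S" and v: "v \<in> carrier G"
    and s: "s \<in> S" "h (v \<otimes> s) \<noteq> h v"
  shows "\<exists>t\<in>S. h (v \<otimes> t) < h v \<or> h (v \<otimes> inv t) < h v"
proof (rule ccontr)
  assume "\<not> ?thesis"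
  then have ge: "h v \<le> h (v \<otimes> t)" "h v \<le> h (v \<otimes> inv t)" if "t \<in> S" for t
    using that by (auto simp: not_less)
  have "(\<Sum>t\<in>S. h (v \<otimes> t) - h v) \<le> 0"
    using h v ge unfolding harmonic_def by (simp add: sum_nonpos)
  moreover have "0 < (\<Sum>t\<in>S. h (v \<otimes> t) - h v)"
    using S s ge by (intro sum_pos2[of S s]) (auto simp: less_le)
  ultimately show False by simp
qed

lemma (in group) harmonic_uminus:
  fixes h :: "'a \<Rightarrow> 'k::comm_ring"
  assumes "harmonic S h"
  shows "harmonic S (\<lambda>v. - h v)"
  unfolding harmonic_def
proof
  fix v assume "v \<in> carrier G"
  then have "- (\<Sum>s\<in>S. h (v \<otimes> s) - h v) = - (\<Sum>s\<in>S. h v - h (v \<otimes> inv s))"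
    using assms unfolding harmonic_def by simp
  then show "(\<Sum>s\<in>S. - h (v \<otimes> s) - - h v) = (\<Sum>s\<in>S. - h v - - h (v \<otimes> inv s))"
    by (simp add: sum_negf[symmetric])
qed

lemma (in group) cayley_graph_neighbours:
  assumes "S \<subseteq> carrier G" and "v \<in> carrier G" and "s \<in> S"
  shows "v \<otimes> s \<in> neighbours (cayley_graph G S) v"
    and "v \<otimes> inv s \<in> neighbours (cayley_graph G S) v"
proof -
  have s: "s \<in> carrier G" using assms by blast
  show "v \<otimes> s \<in> neighbours (cayley_graph G S) v"
    using assms s by (auto simp: neighbours_def cayley_graph_def)
  \<comment> \<open>The edge labelled \<open>s\<close> that starts at
    \<open>v \<otimes> inv s\<close>, traversed backwards.\<close>
  have "{v, v \<otimes> inv s} = {v \<otimes> inv s, (v \<otimes> inv s) \<otimes> s}"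
    using assms s by (auto simp: m_assoc)
  then show "v \<otimes> inv s \<in> neighbours (cayley_graph G S) v"
    using assms s unfolding neighbours_def cayley_graph_def by auto
qed

lemma (in group) strong_height_if_indicable:
  assumes ind: "virtually_HF_indicable G H F" and S: "generating_set G S"
  shows "\<exists>h. strong_graph_height_function G (cayley_graph G S) h H"
proof -
  have one: "\<one> \<in> carrier G" by simp
  have fin: "finite (rcosets H)" and F: "F \<in> epi (G\<lparr>carrier := H\<rparr>) integer_group"
    and idx: "finite_index_normal H G"
    using ind by (auto simp: virtually_HF_indicable_def finite_index_normal_def)
  interpret normal H G
    using ind by (auto simp: virtually_HF_indicable_def finite_index_normal_def)
  have Fhom: "F \<in> hom (G\<lparr>carrier := H\<rparr>) integer_group"
    using F by (simp add: epi_def)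
  obtain \<alpha> where \<alpha>: "\<alpha> \<in> H" "F \<alpha> = 1"
  proof -
    have "F ` H = UNIV" using F by (simp add: epi_def integer_group_def)
    then show ?thesis using that by (metis UNIV_I imageE)
  qed
  have "\<alpha> \<in> generate G S" using \<alpha> S mem_carrier by (simp add: generating_set_def)
  \<comment> \<open>Harmonicity is imposed along \<open>T\<close> only; since
    \<open>T \<subseteq> S\<close>, neighbours found along \<open>T\<close> are neighbours in the
    full Cayley graph.\<close>
  then obtain T where T: "finite T" "T \<subseteq> S" "\<alpha> \<in> generate G T"
    using generate_finite_subset by blast
  have SG: "S \<subseteq> carrier G" using S by (simp add: generating_set_def)
  then have TG: "T \<subseteq> carrier G" using T by blast
  obtain D f where Df: "D > 0" "harmonic T f"
      "\<forall>\<alpha>\<in>H. \<forall>v\<in>carrier G. f (\<alpha> \<otimes> v) = D * F \<alpha> + f v"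
    using harmonic_extension[OF Fhom fin T(1) TG] by blast
  have feq: "equivariant H f"
    using Df(3) by (simp add: equivariant_def)
  \<comment> \<open>The two values differ by \<open>D * F \<alpha> = D > 0\<close>.\<close>
  have "f (\<one> \<otimes> \<alpha>) \<noteq> f \<one>"
    using Df(1,3) \<alpha> by (metis add_cancel_left_left l_one less_irrefl mem_carrier mult.right_neutral one r_one)
  then obtain v0 s0 where v0: "v0 \<in> carrier G" "s0 \<in> T" "f (v0 \<otimes> s0) \<noteq> f v0"
    using constant_on_generate[OF TG T(3) one, of f] by blast
  obtain rep where rep: "\<And>v. v \<in> carrier G \<Longrightarrow> rep (H #> v) \<in> carrier G"
      "\<And>v. v \<in> carrier G \<Longrightarrow> \<exists>\<beta>\<in>H. v = \<beta> \<otimes> rep (H #> v)"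
    using coset_representatives by blast
  \<comment> \<open>One vertex per coset: a finite set, from which equivariance carries
    non-constancy to every vertex.\<close>
  have A: "finite (rep ` (rcosets H))" "rep ` (rcosets H) \<subseteq> carrier G"
    using fin rep by (auto simp: RCOSETS_def)
  obtain h :: "'a \<Rightarrow> int" where h: "harmonic T h" "equivariant H h"
      "\<forall>v\<in>rep ` (rcosets H). \<exists>s\<in>T. h (v \<otimes> s) \<noteq> h v"
    using harmonic_nowhere_locally_constant[OF Df(2) feq TG v0 A] by blast
  have nonconst: "\<exists>s\<in>T. h (v \<otimes> s) \<noteq> h v" if v: "v \<in> carrier G" for v
  proof -
    let ?r = "rep (H #> v)"
    have r: "?r \<in> carrier G" using rep(1)[OF v] .
    obtain \<beta> where \<beta>: "\<beta> \<in> H" "v = \<beta> \<otimes> ?r" using rep(2)[OF v] by blast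
    have "H #> v \<in> rcosets H" using v by (auto simp: RCOSETS_def)
    then obtain s where s: "s \<in> T" "h (?r \<otimes> s) \<noteq> h ?r" using h(3) by blast
    have sc: "s \<in> carrier G" using s TG by blast
    have "h (\<beta> \<otimes> (?r \<otimes> s)) - h (\<beta> \<otimes> ?r) = h (?r \<otimes> s) - h ?r"
      using h(2) \<beta>(1) r sc unfolding equivariant_def by blast
    moreover have "\<beta> \<otimes> (?r \<otimes> s) = v \<otimes> s"
      using \<beta> r sc by (metis m_assoc mem_carrier)
    ultimately show ?thesis using s \<beta>(2)[symmetric] by (intro bexI[of _ s]) auto
  qed
  have updown: "\<exists>u\<in>neighbours (cayley_graph G S) v. \<exists>w\<in>neighbours (cayley_graph G S) v.
      h u < h v \<and> h v < h w" if v: "v \<in> carrier G" for v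
  proof -
    obtain s where s: "s \<in> T" "h (v \<otimes> s) \<noteq> h v" using nonconst[OF v] by blast
    have nb: "v \<otimes> t \<in> neighbours (cayley_graph G S) v"
        "v \<otimes> inv t \<in> neighbours (cayley_graph G S) v" if "t \<in> T" for t
      using cayley_graph_neighbours[OF SG v] that T by auto
    have "\<exists>t\<in>T. h (v \<otimes> t) < h v \<or> h (v \<otimes> inv t) < h v"
      using harmonic_has_lower[OF h(1) T(1) v s] .
    \<comment> \<open>A higher neighbour for \<open>h\<close> is a lower one for
      \<open>- h\<close>.\<close>
    moreover have "\<exists>t\<in>T. - h (v \<otimes> t) < - h v \<or> - h (v \<otimes> inv t) < - h v"
      using harmonic_has_lower[OF harmonic_uminus[OF h(1)] T(1) v s(1)] s(2) by simp
    ultimately show ?thesis using nb by (metis neg_less_iff_less)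
  qed
  have "strong_graph_height_function G (cayley_graph G S) (\<lambda>v. h v - h \<one>) H"
    using idx h(2) updown
    by (auto simp: strong_graph_height_function_def equivariant_def cayley_graph_def)
  then show ?thesis by blast
qed

section \<open>Indicability from height functions\<close>

text \<open>The image is a nonzero subgroup of the integers, hence consists of the multiples of its
  least positive element \<open>d\<close>; dividing \<open>h\<close> by \<open>d\<close> makes it
  surjective.\<close>

lemma (in group) epi_of_nonzero_hom:
  fixes h :: "'a \<Rightarrow> int"
  assumes h: "h \<in> hom G integer_group" and nz: "x \<in> carrier G" "h x \<noteq> 0"
  shows "\<exists>F. F \<in> epi G integer_group"
proof -
  interpret h: group_hom G integer_group h
    using h group_integer_group is_group by (simp add: group_hom_def group_hom_axioms_def)
  have mult: "h (a \<otimes> b) = h a + h b" if "a \<in> carrier G" "b \<in> carrier G" for a b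
    using h that by (simp add: hom_def integer_group_def)
  have inv: "h (inv a) = - h a" if "a \<in> carrier G" for a
    using h.hom_inv[OF that] by simp
  have pow: "h (a [^] n) = n * h a" if "a \<in> carrier G" for a and n :: int
    using h.hom_int_pow[OF that, of n] by simp
  define P where "P n \<longleftrightarrow> n > 0 \<and> (\<exists>a\<in>carrier G. h a = int n)" for n :: nat
  have "\<exists>n. P n"
  proof (cases "h x > 0")
    case True
    then show ?thesis using nz by (intro exI[of _ "nat (h x)"]) (auto simp: P_def)
  next
    case False
    then show ?thesis using nz inv[of x]
      by (intro exI[of _ "nat (- h x)"]) (auto simp: P_def intro!: bexI[of _ "inv x"])
  qed
  then have least: "P (LEAST n. P n)" by (rule LeastI_ex)
  define d where "d = (LEAST n. P n)"
  obtain b where b: "d > 0" "b \<in> carrier G" "h b = int d"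
    using least by (auto simp: P_def d_def)
  have dvd: "int d dvd h a" if a: "a \<in> carrier G" for a
  proof (rule ccontr)
    assume "\<not> int d dvd h a"
    then have pos: "h a mod int d > 0"
      using b by (metis dvd_eq_mod_eq_0 of_nat_0_less_iff order_le_less pos_mod_sign)
    \<comment> \<open>A nonzero remainder would be a positive value of \<open>h\<close> below
      \<open>d\<close>.\<close>
    have "h (a \<otimes> b [^] (- (h a div int d))) = h a mod int d"
      using a b by (simp add: mult pow minus_div_mult_eq_mod[symmetric])
    then have "P (nat (h a mod int d))"
      using pos a b by (auto simp: P_def intro!: bexI[of _ "a \<otimes> b [^] (- (h a div int d))"])
    then have "d \<le> nat (h a mod int d)" unfolding d_def by (rule Least_le)
    then show False using b pos_mod_bound[of "int d" "h a"] by linarith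
  qed
  define F where "F a = h a div int d" for a
  have "F \<in> hom G integer_group"
    using dvd by (auto simp: hom_def F_def mult)
  moreover have "\<exists>a\<in>carrier G. F a = n" for n
    using b by (intro bexI[of _ "b [^] n"]) (auto simp: F_def pow)
  then have "F ` carrier G = UNIV" by (auto simp: image_iff) metis
  ultimately show ?thesis by (auto simp: epi_def)
qed

lemma (in group) indicable_if_strong_height:
  assumes S: "generating_set G S" and h: "strong_graph_height_function G (cayley_graph G S) h H"
  shows "virtually_H_indicable G H"
proof -
  have one: "\<one> \<in> carrier G" by simp
  have idx: "finite_index_normal H G" and h1: "h \<one> = 0"
    and heq: "\<forall>\<alpha>\<in>H. \<forall>u\<in>carrier G. \<forall>v\<in>carrier G. h (\<alpha> \<otimes> v) - h (\<alpha> \<otimes> u) = h v - h u"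
    and up: "\<forall>v\<in>carrier G. \<exists>w\<in>carrier G. h v < h w"
    using h by (fastforce simp: strong_graph_height_function_def cayley_graph_def neighbours_def)+
  have fin: "finite (rcosets H)" using idx by (simp add: finite_index_normal_def)
  interpret normal H G using idx by (simp add: finite_index_normal_def)
  \<comment> \<open>Equivariance with \<open>u = \<one>\<close>, where \<open>h\<close>
    vanishes.\<close>
  have mult: "h (\<alpha> \<otimes> v) = h \<alpha> + h v" if "\<alpha> \<in> H" "v \<in> carrier G" for \<alpha> v
    using heq[rule_format, OF that(1) one that(2)] h1 that mem_carrier by simp
  have "\<exists>\<alpha>\<in>H. h \<alpha> \<noteq> 0"
  proof (rule ccontr)
    assume "\<not> ?thesis"
    \<comment> \<open>If \<open>h\<close> vanishes on \<open>H\<close>, it is constant on each of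
      the finitely many cosets, so its range is finite.\<close>
    then have coset: "h ` (H #> v) \<subseteq> {h v}" if "v \<in> carrier G" for v
      using that mult by (auto simp: r_coset_def)
    have "finite (h ` C)" if "C \<in> rcosets H" for C
      using that finite_subset[OF coset] unfolding RCOSETS_def by blast
    then have "finite (\<Union>C\<in>rcosets H. h ` C)" using fin by blast
    then have finh: "finite (h ` carrier G)"
      using rcosets_part_G[OF is_subgroup] by (simp add: image_Union[symmetric])
    have "Max (h ` carrier G) \<in> h ` carrier G"
      using finh one by (intro Max_in) blast+
    then obtain v where v: "v \<in> carrier G" "h v = Max (h ` carrier G)"
      by (metis imageE)
    then obtain w where "w \<in> carrier G" "h v < h w" using up by blast
    then show False using v Max_ge[OF finh, of "h w"] by simp
  qed
  moreover have "h \<in> hom (G\<lparr>carrier := H\<rparr>) integer_group"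
    using mult mem_carrier by (auto simp: hom_def)
  moreover have "group (G\<lparr>carrier := H\<rparr>)"
    by (rule subgroup_is_group[OF is_group])
  ultimately obtain F where "F \<in> epi (G\<lparr>carrier := H\<rparr>) integer_group"
    using group.epi_of_nonzero_hom[of "G\<lparr>carrier := H\<rparr>" h] by auto
  then show ?thesis
    using idx by (auto simp: virtually_H_indicable_def virtually_HF_indicable_def)
qed

theorem theorem3p2:
  fixes \<Gamma> :: "('a, 'b) monoid_scheme"
  assumes "group \<Gamma>" and "finitely_generated \<Gamma>"
  shows "(\<forall>\<H> F. virtually_HF_indicable \<Gamma> \<H> F \<longrightarrow>
            (\<forall>G. is_cayley_graph_of G \<Gamma> \<longrightarrow> (\<exists>h. strong_graph_height_function \<Gamma> G h \<H>))) \<and>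
         (\<forall>\<H>. (\<exists>G h. is_cayley_graph_of G \<Gamma> \<and> strong_graph_height_function \<Gamma> G h \<H>) \<longrightarrow>
            virtually_H_indicable \<Gamma> \<H>)"
  using group.strong_height_if_indicable[OF assms(1)] group.indicable_if_strong_height[OF assms(1)]
  unfolding is_cayley_graph_of_def by blast

end
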